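(* Let $\tau\in\mathbb{R}$, let $r,p:[\tau,\infty)\to\mathbb{R}$, $f:[\tau,\infty)\times\mathbb{R}\to\mathbb{R}$ and $\phi:\mathbb{R}\to\mathbb{R}$ satisfy the standing assumptions listed in the context, and let $\gamma$ be a piecewise constant argument of generalized type with associated sequences $(t_n)_{n\in\mathbb{Z}}$, $(\zeta_n)_{n\in\mathbb{Z}}$. For $s\in\mathbb{R}$ let $k(s)$ denote the unique integer such that $s\in[t_{k(s)},t_{k(s)+1})$. Suppose that $$\int_\tau^\infty \frac{1}{r(s)}\,ds=\infty .$$ Let $\varepsilon>0$. If $$\int_{\varepsilon}^\infty\frac{1}{\phi(u)}\,du<\infty,\qquad \int_{-\varepsilon}^{-\infty}\frac{1}{\phi(u)}\,du<\infty,$$ and $$\int_{\tau}^\infty p(u)\,du<\infty,\qquad \int_{\tau}^{\infty}\frac{1}{r(s)}\left(\int_{t_{k(s)+1}}^\infty p(u)\,du\right)ds=\infty,$$ then every solution on $[\tau,\infty)$ of the equation $$(r(t)x'(t))'+f(t,x(\gamma(t)))=0,\qquad t\ge\tau,$$ is oscillatory.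
   Context: Piecewise constant argument of generalized type: let $(t_n)_{n\in\mathbb{Z}}$ and $(\zeta_n)_{n\in\mathbb{Z}}$ be real sequences with $t_n<t_{n+1}$ for all $n$, $\lim_{n\to\infty}t_n=\infty$, $\lim_{n\to-\infty}t_n=-\infty$, and $\zeta_n\in[t_n,t_{n+1}]$ for all $n$. Then $\gamma(t)=\zeta_n$ for $t\in I_n=[t_n,t_{n+1})$. Standing assumptions: $r$ is continuous (hence locally integrable) and positive on $[\tau,\infty)$; $f$ is continuous on $[\tau,\infty)\times\mathbb{R}$ and $x f(t,x)>0$ for all $t\ge\tau$, $x\ne0$; $p$ is continuous and nonnegative on $[\tau,\infty)$; $\phi$ is continuously differentiable and nondecreasing on $\mathbb{R}$ with $x\phi(x)>0$ for $x\neq0$; and $\dfrac{f(t,x)}{\phi(x)}\ge p(t)$ for all $x\ne0$, $t\ge\tau$. Solution: a continuous function $x:[\tau,\infty)\to\mathbb{R}$ is a solution on $[\tau,\infty)$ if (i) $x$ is continuously differentiable on $[\tau,\infty)$; (ii) $(r(t)x'(t))'$ exists for all $t\in[\tau,\infty)$ except possibly at the points $t_k$, where it has one-sided limits; (iii) $x$ satisfies the equation on each interval $[t_k,t_{k+1})\subset[\tau,\infty)$ (with the right-hand derivative of $r x'$ used at $t_k$). Oscillatory: a function $g$ defined on $[t_0,\infty)$ is oscillatory if there exist sequences $(a_n),(b_n)\subset[t_0,\infty)$ with $a_n\to\infty$, $b_n\to\infty$ and $g(a_n)\le 0\le g(b_n)$ for all sufficiently large $n$; equivalently, $g$ is neither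 eventually strictly positive nor eventually strictly negative. The integral $\int_{-\varepsilon}^{-\infty}\frac{du}{\phi(u)}$ is oriented from $-\varepsilon$ to $-\infty$ (so it equals $\int_{-\infty}^{-\varepsilon}\frac{du}{|\phi(u)|}\ge0$). *)

theory Defs
  imports "HOL-Analysis.Analysis"
begin

definition piecewise_constant_argument ::
  "(int \<Rightarrow> real) \<Rightarrow> (int \<Rightarrow> real) \<Rightarrow> (real \<Rightarrow> real) \<Rightarrow> bool" where
  "piecewise_constant_argument t \<zeta> \<gamma> \<longleftrightarrow>
     (\<forall>n. t n < t (n + 1)) \<and>
     filterlim t at_top at_top \<and>
     filterlim t at_bot at_bot \<and>
     (\<forall>n. \<zeta> n \<in> {t n..t (n + 1)}) \<and>
     (\<forall>n. \<forall>s\<in>{t n..<t (n + 1)}. \<gamma> s = \<zeta> n)"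

definition interval_index :: "(int \<Rightarrow> real) \<Rightarrow> real \<Rightarrow> int" where
  "interval_index t s = (THE n. s \<in> {t n..<t (n + 1)})"

(* Functions on [\<tau>,\<infinity>) are total functions of which only the values on {\<tau>..} matter, so
   derivatives at \<tau> are taken within {\<tau>..}. Here x' is the derivative of x and D the
   derivative of r x' off the points t k; the values of D at the points t k are irrelevant.
   In the last clause the derivative within {t k..<t (k + 1)} is the right-hand derivative at
   t k and the ordinary derivative at the other points. The equation is required only on
   those intervals that lie entirely in [\<tau>,\<infinity>), where \<gamma> s \<ge> \<tau>. *)
definition is_solution ::
  "real \<Rightarrow> (int \<Rightarrow> real) \<Rightarrow> (real \<Rightarrow> real) \<Rightarrow> (real \<Rightarrow> real) \<Rightarrow> (real \<Rightarrow> real \<Rightarrow> real) \<Rightarrow>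
   (real \<Rightarrow> real) \<Rightarrow> bool" where
  "is_solution \<tau> t \<gamma> r f x \<longleftrightarrow>
     continuous_on {\<tau>..} x \<and>
     (\<exists>x'.
       (\<forall>s\<ge>\<tau>. (x has_real_derivative x' s) (at s within {\<tau>..})) \<and>
       continuous_on {\<tau>..} x' \<and>
       (\<exists>D.
         (\<forall>s\<in>{\<tau>..} - range t.
            ((\<lambda>u. r u * x' u) has_real_derivative D s) (at s within {\<tau>..})) \<and>
         (\<forall>k. \<tau> \<le> t k \<longrightarrow> (\<exists>l. (D \<longlongrightarrow> l) (at_right (t k)))) \<and>
         (\<forall>k. \<tau> < t k \<longrightarrow> (\<exists>l. (D \<longlongrightarrow> l) (at_left (t k))))) \<and>
       (\<forall>k. {t k..<t (k + 1)} \<subseteq> {\<tau>..} \<longrightarrow>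
         (\<forall>s\<in>{t k..<t (k + 1)}.
            \<exists>d. ((\<lambda>u. r u * x' u) has_real_derivative d) (at s within {t k..<t (k + 1)}) \<and>
                d + f s (x (\<gamma> s)) = 0)))"

definition oscillatory :: "real \<Rightarrow> (real \<Rightarrow> real) \<Rightarrow> bool" where
  "oscillatory t0 g \<longleftrightarrow>
     (\<exists>a b :: nat \<Rightarrow> real.
        range a \<subseteq> {t0..} \<and> range b \<subseteq> {t0..} \<and>
        filterlim a at_top sequentially \<and> filterlim b at_top sequentially \<and>
        (\<forall>\<^sub>F n in sequentially. g (a n) \<le> 0 \<and> 0 \<le> g (b n)))"

end

theory Submission
  imports Defs
begin

text \<open>
  A solution that does not oscillate is eventually positive or eventually negative, and replacing
  \<open>x\<close>, \<open>f s u\<close>, \<open>\<phi> u\<close> by \<open>- x\<close>, \<open>- f s (- u)\<close>, \<open>- \<phi> (- u)\<close> reduces the second case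
  to the first. If \<open>x\<close> is eventually positive, then \<open>y = r x'\<close> is eventually decreasing, and
  \<open>y \<ge> 0\<close>: otherwise \<open>x' \<le> - c / r\<close> with \<open>c > 0\<close>, and the divergence of \<open>\<integral> 1 / r\<close> would drive
  \<open>x\<close> to \<open>- \<infinity>\<close>. Hence \<open>x\<close> is increasing. For \<open>s\<close> in the \<open>k\<close>-th interval and
  \<open>v \<ge> t (k + 1)\<close> we have \<open>\<gamma> v \<ge> t (k + 1) \<ge> s\<close>, so \<open>- y' v \<ge> p v * \<phi> (x (\<gamma> v)) \<ge> p v * \<phi> (x s)\<close>.
  Integrating over \<open>v\<close> gives \<open>x' s / \<phi> (x s) \<ge> 1 / r s * \<integral> p\<close> with the integral over
  \<open>v \<ge> t (k + 1)\<close>. The left-hand side has the bounded antiderivative \<open>G \<circ> x\<close>, where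
  \<open>G' = 1 / \<phi>\<close>, whereas the integral of the right-hand side diverges.
\<close>

text \<open>Up to \<open>a\<close> the constant \<open>K\<close> bounds the integrand on a set of
  finite measure; beyond \<open>a\<close> the integral is at most the total increase of the bounded
  nondecreasing function \<open>F\<close>. Each divergent integral below is refuted by exhibiting
  such an \<open>F\<close>.\<close>

lemma nn_set_integral_finite_if_bounded_antiderivative:
  fixes g F F' :: "real \<Rightarrow> real"
  assumes ab: "\<tau> \<le> a"
    and K: "\<And>s. \<tau> \<le> s \<Longrightarrow> s \<le> a \<Longrightarrow> g s \<le> K"
    and le: "\<And>s. a \<le> s \<Longrightarrow> g s \<le> F' s"
    and nonneg: "\<And>s. a \<le> s \<Longrightarrow> 0 \<le> F' s"
    and cont: "continuous_on {a..} F'"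
    and deriv: "\<And>s. a \<le> s \<Longrightarrow> (F has_real_derivative F' s) (at s)"
    and B: "\<And>s. a \<le> s \<Longrightarrow> F s \<le> B"
  shows "(\<integral>\<^sup>+ s\<in>{\<tau>..}. ennreal (g s) \<partial>lborel) < \<infinity>"
proof -
  \<comment> \<open>\<open>F'\<close> is controlled only on \<open>{a..}\<close>; cutting it off
    gives a Borel function on the whole line, as the fundamental theorem of calculus
    requires.\<close>
  define q where "q = (\<lambda>s. indicator {a..} s * F' s)"
  have q: "q \<in> borel_measurable borel"
    using borel_measurable_continuous_on_indicator[OF _ cont] by (simp add: q_def)
  have q_eq: "q s = F' s" if "a \<le> s" for s
    using that by (simp add: q_def)
  have mono: "F u \<le> F v" if "a \<le> u" "u \<le> v" for u v
    using that(2) by (rule DERIV_nonneg_imp_nondecreasing) (use deriv nonneg that(1) order_trans in blast)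
  have bdd: "bdd_above (F ` {a..})"
    using B by (intro bdd_aboveI2[of _ _ B]) auto
  have lim: "(F \<longlongrightarrow> (SUP s\<in>{a..}. F s)) at_top"
  proof (rule increasing_tendsto)
    show "\<forall>\<^sub>F s in at_top. F s \<le> (SUP s\<in>{a..}. F s)"
      using eventually_ge_at_top[of a] by eventually_elim (auto intro!: cSUP_upper bdd)
  next
    fix y assume "y < (SUP s\<in>{a..}. F s)"
    then obtain u where u: "a \<le> u" "y < F u"
      by (subst (asm) less_cSUP_iff) (auto simp: bdd)
    show "\<forall>\<^sub>F s in at_top. y < F s"
      using eventually_ge_at_top[of u] by eventually_elim (use u mono in force)
  qed
  have "(\<integral>\<^sup>+ s\<in>{\<tau>..}. ennreal (g s) \<partial>lborel)
      \<le> (\<integral>\<^sup>+ s. ennreal K * indicator {\<tau>..a} s + ennreal (q s) * indicator {a..} s \<partial>lborel)"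
  proof (rule nn_integral_mono)
    fix s
    show "ennreal (g s) * indicator {\<tau>..} s
        \<le> ennreal K * indicator {\<tau>..a} s + ennreal (q s) * indicator {a..} s"
      using K[of s] le[of s] ab
      by (cases "a \<le> s"; cases "s = a")
         (auto simp: q_eq ennreal_leI add_increasing split: split_indicator)
  qed
  also have "\<dots> = ennreal K * emeasure lborel {\<tau>..a}
      + (\<integral>\<^sup>+ s. ennreal (q s) * indicator {a..} s \<partial>lborel)"
    using q by (subst nn_integral_add) (auto simp: nn_integral_cmult_indicator)
  also have "(\<integral>\<^sup>+ s. ennreal (q s) * indicator {a..} s \<partial>lborel) = ennreal ((SUP s\<in>{a..}. F s) - F a)"
    using deriv nonneg by (intro nn_integral_FTC_atLeast q lim) (auto simp: q_eq)
  also have "ennreal K * emeasure lborel {\<tau>..a} + ennreal ((SUP s\<in>{a..}. F s) - F a) < \<infinity>"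
    using ab by (simp add: ennreal_mult_less_top)
  finally show ?thesis .
qed

text \<open>Links three forms of one integral: the improper integral from \<open>v\<close>, the
  gauge integrals over \<open>{v..V}\<close>, which can be differentiated in \<open>V\<close>, and
  the integral over \<open>{a<..}\<close>, a bound independent of \<open>v\<close> and
  \<open>V\<close>. Applied to \<open>p\<close> and to \<open>1 / \<phi>\<close>.\<close>

lemma interval_integral_to_infinity:
  fixes q :: "real \<Rightarrow> real"
  assumes int: "set_integrable lborel {a<..} q" and v: "a < v"
    and nonneg: "\<And>u. a < u \<Longrightarrow> 0 \<le> q u"
  shows "((\<lambda>V. integral {v..V} q) \<longlongrightarrow> (LBINT u=ereal v..\<infinity>. q u)) at_top" (is ?lim)
    and "integral {v..V} q \<le> (LBINT u:{a<..}. q u)" (is ?le)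
    and "(LBINT u=ereal v..\<infinity>. q u) \<le> (LBINT u:{a<..}. q u)" (is ?inf)
proof -
  have int': "set_integrable lborel {v..V} q" for V
    using v by (intro set_integrable_subset[OF int]) auto
  have Ici: "set_integrable lborel {v..} q"
    using v by (intro set_integrable_subset[OF int]) auto
  \<comment> \<open>The improper integral is taken over the open ray, the limit theorem over the
    closed one; they differ by a null set.\<close>
  have "(LBINT u:{v<..}. q u) = (LBINT u:{v..}. q u)"
    by (rule set_integral_discrete_difference[where X = "{v}"]) auto
  then show lim: ?lim
    using tendsto_set_lebesgue_integral_at_top[OF _ Ici]
    by (simp add: interval_integral_to_infinity_eq set_borel_integral_eq_integral(2)[OF int'])
  have le: "integral {v..V} q \<le> (LBINT u:{a<..}. q u)" for V
    using v nonneg int int'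
    by (simp add: set_borel_integral_eq_integral(2))
       (intro integral_subset_le set_borel_integral_eq_integral(1), auto)
  show ?le by (rule le)
  show ?inf
    by (rule tendsto_upperbound[OF lim]) (auto simp: le)
qed

text \<open>Needed because \<open>r x'\<close> may have a corner at each \<open>t k\<close>.
  Continuity glues the monotonicity on the pieces together, and since \<open>t\<close> tends to
  infinity, finitely many pieces reach \<open>b\<close>.\<close>

lemma antimono_if_antimono_on_partition:
  fixes t :: "int \<Rightarrow> real" and w :: "real \<Rightarrow> real"
  assumes t: "\<And>n. t n < t (n + 1)" "filterlim t at_top at_top"
    and cont: "continuous_on {t N..} w"
    and deriv: "\<And>k s. N \<le> k \<Longrightarrow> t k < s \<Longrightarrow> s < t (k + 1) \<Longrightarrow>
      \<exists>d. (w has_real_derivative d) (at s) \<and> d \<le> 0"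
    and ab: "t N \<le> a" "a \<le> b"
  shows "w b \<le> w a"
proof -
  have tN: "t N \<le> t (N + int n)" for n
  proof (induction n)
    case (Suc n)
    then show ?case
      using t(1)[of "N + int n"] by (simp add: algebra_simps)
  qed auto
  have "w v \<le> w u" if "t N \<le> u" "u \<le> v" "v \<le> t (N + int n)" for n u v
    using that
  proof (induction n arbitrary: u v)
    case 0
    then have "u = v" by simp
    then show ?case by simp
  next
    case (Suc n)
    let ?m = "t (N + int n)"
    have piece: "w v \<le> w z" if "?m \<le> z" "z \<le> v" for z
    proof (rule DERIV_nonpos_imp_decreasing_open[OF that(2)])
      show "continuous_on {z..v} w"
        using that tN[of n] by (intro continuous_on_subset[OF cont]) auto
      show "\<exists>y. (w has_real_derivative y) (at s) \<and> y \<le> 0" if "z < s" "s < v" for s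
        using deriv[of "N + int n" s] Suc.prems that \<open>?m \<le> z\<close> by (simp add: algebra_simps)
    qed
    consider "v \<le> ?m" | "?m \<le> u" | "u \<le> ?m" "?m \<le> v" by linarith
    then show ?case
    proof cases
      case 1
      then show ?thesis using Suc by blast
    next
      case 2
      then show ?thesis using piece Suc.prems by blast
    next
      case 3
      then show ?thesis
        using piece[of ?m] Suc.IH[of u ?m] Suc.prems by auto
    qed
  qed
  moreover obtain n where "b \<le> t (N + int n)"
  proof -
    obtain M where M: "\<And>k. M \<le> k \<Longrightarrow> b \<le> t k"
      using t(2) by (auto simp: filterlim_at_top eventually_at_top_linorder)
    show thesis
      using that[of "nat (M - N)"] M[of "N + int (nat (M - N))"] by auto
  qed
  ultimately show ?thesis
    using ab by blast
qed

lemma piecewise_constant_argument_mono: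
  assumes "piecewise_constant_argument t \<zeta> \<gamma>"
  shows "mono t"
proof -
  have "t m \<le> t n" if "m \<le> n" for m n
    using that
  proof (induction n rule: int_ge_induct)
    case (step i)
    then show ?case
      using assms less_imp_le[of "t i" "t (i + 1)"]
      by (auto simp: piecewise_constant_argument_def intro: order_trans)
  qed auto
  then show ?thesis by (rule monoI)
qed

text \<open>The index is a definite description: existence follows from \<open>t\<close> being
  unbounded in both directions, uniqueness from its monotonicity.\<close>

lemma interval_index_bounds:
  assumes pca: "piecewise_constant_argument t \<zeta> \<gamma>"
  shows "t (interval_index t s) \<le> s" "s < t (interval_index t s + 1)"
proof -
  note mono = monoD[OF piecewise_constant_argument_mono[OF pca]]
  have "filterlim t at_bot at_bot" "filterlim t at_top at_top"
    using pca by (auto simp: piecewise_constant_argument_def)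
  \<comment> \<open>The summand 1 yields the strict bound \<open>s < t U\<close>. Counting upwards
    from \<open>L\<close> then allows a least natural number to be chosen; its predecessor is the
    index sought.\<close>
  then obtain L U where L: "t L \<le> s" and "s + 1 \<le> t U"
    unfolding filterlim_at_bot filterlim_at_top eventually_at_bot_linorder
      eventually_at_top_linorder by (meson order_refl)
  then have "L \<le> U"
    using mono[of U L] by linarith
  with \<open>s + 1 \<le> t U\<close> have "\<exists>n. s < t (L + int n)"
    by (intro exI[of _ "nat (U - L)"]) auto
  then obtain n where n: "s < t (L + int n)" "\<And>m. m < n \<Longrightarrow> \<not> s < t (L + int m)"
    unfolding exists_least_iff[of "\<lambda>n. s < t (L + int n)"] by blast
  have "n \<noteq> 0"
    using n(1) L by (intro notI) simp
  then obtain m where m: "n = Suc m"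
    by (cases n) auto
  have ex: "s \<in> {t (L + int m)..<t (L + int m + 1)}"
    using n(1) n(2)[of m] by (auto simp: m algebra_simps)
  moreover have "i = j" if "s \<in> {t i..<t (i + 1)}" "s \<in> {t j..<t (j + 1)}" for i j
    using that mono[of "i + 1" j] mono[of "j + 1" i]
    by (cases i j rule: linorder_cases) auto
  ultimately have "s \<in> {t (interval_index t s)..<t (interval_index t s + 1)}"
    unfolding interval_index_def by (intro theI[where P = "\<lambda>n. s \<in> {t n..<t (n + 1)}"])
  then show "t (interval_index t s) \<le> s" "s < t (interval_index t s + 1)"
    by auto
qed

text \<open>\<open>\<gamma> s\<close> may lie on either side of \<open>s\<close>, but it stays in
  the closure of the interval containing \<open>s\<close>, so it never drops below a grid point that
  \<open>s\<close> has reached.\<close>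

lemma piecewise_constant_argument_ge:
  assumes pca: "piecewise_constant_argument t \<zeta> \<gamma>" and s: "t n \<le> s"
  shows "t n \<le> \<gamma> s"
proof -
  let ?k = "interval_index t s"
  note idx = interval_index_bounds[OF pca, of s]
  note mono = piecewise_constant_argument_mono[OF pca]
  have "n \<le> ?k"
    using monoD[OF mono, of "?k + 1" n] idx s by linarith
  then have "t n \<le> t ?k"
    by (rule monoD[OF mono])
  moreover have "t ?k \<le> \<zeta> ?k" "\<gamma> s = \<zeta> ?k"
    using pca idx by (auto simp: piecewise_constant_argument_def)
  ultimately show ?thesis by simp
qed

text \<open>The sign, continuity and growth conditions on \<open>\<phi>\<close> and \<open>f\<close>
  concern positive arguments only, so the reflected data can be substituted to exclude eventually
  negative solutions.\<close>

lemma no_eventually_positive_solution: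
  fixes \<tau> \<epsilon> T :: real
    and r p \<phi> \<gamma> x :: "real \<Rightarrow> real"
    and f :: "real \<Rightarrow> real \<Rightarrow> real"
    and t \<zeta> :: "int \<Rightarrow> real"
  assumes r_cont: "continuous_on {\<tau>..} r"
    and r_pos: "\<And>s. s \<ge> \<tau> \<Longrightarrow> r s > 0"
    and p_cont: "continuous_on {\<tau>..} p"
    and p_nonneg: "\<And>s. s \<ge> \<tau> \<Longrightarrow> p s \<ge> 0"
    and phi_cont: "continuous_on {0<..} \<phi>"
    and phi_mono: "mono \<phi>"
    and phi_pos: "\<And>u. u > 0 \<Longrightarrow> \<phi> u > 0"
    and f_ge: "\<And>s u. s \<ge> \<tau> \<Longrightarrow> u > 0 \<Longrightarrow> p s * \<phi> u \<le> f s u"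
    and pca: "piecewise_constant_argument t \<zeta> \<gamma>"
    and r_int: "(\<integral>\<^sup>+ s\<in>{\<tau>..}. ennreal (1 / r s) \<partial>lborel) = \<infinity>"
    and phi_int: "set_integrable lborel {\<epsilon><..} (\<lambda>u. 1 / \<phi> u)"
    and p_int: "set_integrable lborel {\<tau><..} p"
    and rp_int: "(\<integral>\<^sup>+ s\<in>{\<tau>..}.
        ennreal (1 / r s * (LBINT u=ereal (t (interval_index t s + 1))..\<infinity>. p u)) \<partial>lborel) = \<infinity>"
    and sol: "is_solution \<tau> t \<gamma> r f x"
    and x_pos: "\<And>s. s \<ge> T \<Longrightarrow> x s > 0"
  shows False
proof -

  \<comment> \<open>The solution and \<open>y = r x'\<close> beyond a grid point\<close>
  have t: "\<And>n. t n < t (n + 1)" "filterlim t at_top at_top"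
    using pca by (auto simp: piecewise_constant_argument_def)
  note t_mono = monoD[OF piecewise_constant_argument_mono[OF pca]]
  note idx = interval_index_bounds[OF pca]
  \<comment> \<open>Starting at a grid point \<open>a\<close> ensures
    \<open>\<gamma> s \<ge> a\<close>, hence \<open>x (\<gamma> s) > 0\<close>, for all
    \<open>s \<ge> a\<close>. The summand 1 makes \<open>a > \<tau>\<close>, so derivatives of
    \<open>x\<close> are two-sided there.\<close>
  obtain N where N: "max \<tau> T + 1 \<le> t N"
    using t(2) by (auto simp: filterlim_at_top eventually_at_top_linorder)
  define a where "a = t N"
  have a: "\<tau> < a" "T < a"
    using N by (auto simp: a_def)
  obtain x' where x': "\<And>s. s \<ge> \<tau> \<Longrightarrow> (x has_real_derivative x' s) (at s within {\<tau>..})"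
    and x'_cont: "continuous_on {\<tau>..} x'"
    and eq: "\<And>k s. {t k..<t (k + 1)} \<subseteq> {\<tau>..} \<Longrightarrow> s \<in> {t k..<t (k + 1)} \<Longrightarrow>
         \<exists>d. ((\<lambda>u. r u * x' u) has_real_derivative d) (at s within {t k..<t (k + 1)}) \<and>
                d + f s (x (\<gamma> s)) = 0"
    using sol unfolding is_solution_def by blast
  have x_deriv: "(x has_real_derivative x' s) (at s)" if "\<tau> < s" for s
    using x'[of s] that at_within_interior[of s "{\<tau>..}"] by (simp add: interior_Ici)
  define y where "y = (\<lambda>u. r u * x' u)"
  have y_cont: "continuous_on {\<tau>..} y"
    unfolding y_def by (intro continuous_intros r_cont x'_cont)
  \<comment> \<open>At \<open>t k\<close> the equation gives only a right-hand derivative; on the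
    open interval it is the ordinary one.\<close>
  have y_deriv: "(y has_real_derivative - f s (x (\<gamma> s))) (at s)"
    if k: "N \<le> k" "t k < s" "s < t (k + 1)" for k s
  proof -
    have "{t k..<t (k + 1)} \<subseteq> {\<tau>..}"
      using t_mono[OF k(1)] a by (auto simp: a_def)
    from eq[OF this, of s] obtain d where
      d: "(y has_real_derivative d) (at s within {t k..<t (k + 1)})" "d = - f s (x (\<gamma> s))"
      using k unfolding y_def eq_neg_iff_add_eq_0 by auto
    have "(y has_real_derivative d) (at s within {t k<..<t (k + 1)})"
      by (rule DERIV_subset[OF d(1)]) auto
    then show ?thesis
      using k d(2) by (simp add: at_within_open[of s "{t k<..<t (k + 1)}"])
  qed
  have f_bound: "p s * \<phi> (x (\<gamma> s)) \<le> f s (x (\<gamma> s))" "x (\<gamma> s) > 0" if "a \<le> s" for s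
  proof -
    show "x (\<gamma> s) > 0"
      using piecewise_constant_argument_ge[OF pca, of N s] that a x_pos by (auto simp: a_def)
    then show "p s * \<phi> (x (\<gamma> s)) \<le> f s (x (\<gamma> s))"
      using that a f_ge by auto
  qed
  have y_decr: "y v \<le> y u" if "a \<le> u" "u \<le> v" for u v
  proof (rule antimono_if_antimono_on_partition[OF t, where w = y])
    show "continuous_on {t N..} y"
      using a by (intro continuous_on_subset[OF y_cont]) (auto simp: a_def)
    show "t N \<le> u" "u \<le> v"
      using that by (auto simp: a_def)
    fix k s assume k: "N \<le> k" "t k < s" "s < t (k + 1)"
    have s: "a \<le> s"
      using t_mono[OF k(1)] k by (auto simp: a_def)
    have "0 \<le> p s * \<phi> (x (\<gamma> s))"
      using s a f_bound(2)[OF s] phi_pos p_nonneg[of s] by (simp add: less_imp_le)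
    then show "\<exists>d. (y has_real_derivative d) (at s) \<and> d \<le> 0"
      using y_deriv[OF k] f_bound(1)[OF s] by fastforce
  qed
  \<comment> \<open>Supplies the bound on the initial segment for both divergence arguments.\<close>
  have inv_r: "\<exists>M\<ge>0. \<forall>s\<in>{\<tau>..b}. 1 / r s \<le> M" for b
  proof -
    have "continuous_on {\<tau>..b} (\<lambda>s. 1 / r s)"
      using r_pos by (intro continuous_intros continuous_on_subset[OF r_cont]) force+
    then have "bounded ((\<lambda>s. 1 / r s) ` {\<tau>..b})"
      by (intro compact_imp_bounded compact_continuous_image) auto
    then obtain M where "0 < M" "\<And>s. s \<in> {\<tau>..b} \<Longrightarrow> \<bar>1 / r s\<bar> \<le> M"
      unfolding bounded_pos real_norm_def by blast
    then show ?thesis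
      by (intro exI[of _ M]) (meson abs_le_D1 less_imp_le)
  qed

  \<comment> \<open>Nonnegativity of \<open>r x'\<close> and monotonicity of
    \<open>x\<close>\<close>
  have y_nonneg: "0 \<le> y s0" if s0: "a \<le> s0" for s0
  proof (rule ccontr)
    assume neg: "\<not> 0 \<le> y s0"
    obtain M where M: "\<And>s. s \<in> {\<tau>..s0} \<Longrightarrow> 1 / r s \<le> M"
      using inv_r by blast
    \<comment> \<open>Dividing \<open>r s * x' s \<le> y s0 < 0\<close> by \<open>y s0\<close>
      reverses it. The antiderivative \<open>x s / y s0\<close> of the majorant is at most 0 because
      \<open>x\<close> is positive.\<close>
    have le: "1 / r s \<le> x' s / y s0" "0 \<le> x' s / y s0" if "s0 \<le> s" for s
    proof -
      have "r s > 0" "r s * x' s \<le> y s0"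
        using r_pos[of s] y_decr[of s0 s] that s0 a by (auto simp: y_def)
      then show "1 / r s \<le> x' s / y s0"
        using neg by (simp add: field_simps)
      then show "0 \<le> x' s / y s0"
        using \<open>r s > 0\<close> by (meson divide_nonneg_pos order_trans zero_le_one)
    qed
    have "(\<integral>\<^sup>+ s\<in>{\<tau>..}. ennreal (1 / r s) \<partial>lborel) < \<infinity>"
    proof (rule nn_set_integral_finite_if_bounded_antiderivative)
      show "\<tau> \<le> s0" using a s0 by simp
      show "1 / r s \<le> M" if "\<tau> \<le> s" "s \<le> s0" for s
        using M that by auto
      show "continuous_on {s0..} (\<lambda>s. x' s / y s0)"
        using neg a s0 by (intro continuous_intros continuous_on_subset[OF x'_cont]) auto
      show "((\<lambda>s. x s / y s0) has_real_derivative x' s / y s0) (at s)" if "s0 \<le> s" for s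
        using that a s0 by (intro DERIV_cdivide x_deriv) auto
      show "x s / y s0 \<le> 0" if "s0 \<le> s" for s
        using that a s0 neg x_pos[of s] by (simp add: divide_nonneg_neg divide_le_0_iff)
    qed (use le in auto)
    then show False using r_int by simp
  qed
  have x'_nonneg: "0 \<le> x' s" if "a \<le> s" for s
    using y_nonneg[OF that] r_pos[of s] a that by (simp add: y_def zero_le_mult_iff)
  have x_incr: "x u \<le> x v" if "a \<le> u" "u \<le> v" for u v
    using that(2)
  proof (rule DERIV_nonneg_imp_nondecreasing)
    show "\<exists>d. (x has_real_derivative d) (at s) \<and> 0 \<le> d" if "u \<le> s" for s
      using x_deriv[of s] x'_nonneg[of s] that \<open>a \<le> u\<close> a by auto
  qed

  \<comment> \<open>Comparison of \<open>r x'\<close> with the tail integral of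
    \<open>p\<close>\<close>
  define P where "P = (\<lambda>v. LBINT u=ereal v..\<infinity>. p u)"
  define C where "C = (LBINT u:{\<tau><..}. p u)"
  have P_lim: "((\<lambda>V. integral {v..V} p) \<longlongrightarrow> P v) at_top"
    and P_le: "P v \<le> C" if "\<tau> < v" for v
    using interval_integral_to_infinity[OF p_int that] p_nonneg by (auto simp: P_def C_def)

  \<comment> \<open>Within the interval containing \<open>s\<close>, \<open>\<gamma>\<close> may
    take a value below \<open>s\<close>. From the next grid point \<open>b\<close> on,
    \<open>\<gamma> v \<ge> b \<ge> s\<close>, so \<open>x (\<gamma> v) \<ge> x s\<close>; hence the
    tail starts at \<open>b\<close>.\<close>
  have y_ge: "\<phi> (x s) * P (t (interval_index t s + 1)) \<le> y s" if s: "a \<le> s" for s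
  proof -
    define m where "m = interval_index t s + 1"
    define b where "b = t m"
    have sb: "s \<le> b" using idx(2)[of s] by (simp add: m_def b_def)
    have m: "N \<le> m"
      using t_mono[of m N] idx(2)[of s] s by (force simp: m_def a_def)
    have "0 < \<phi> (x s)"
      using s a by (intro phi_pos x_pos) auto
    have "\<phi> (x s) * integral {b..V} p \<le> y s" if V: "b \<le> V" for V
    proof -
      have p_cont': "continuous_on {b..c} p" for c
        using s sb a by (intro continuous_on_subset[OF p_cont]) auto
      \<comment> \<open>The equation in integrated form: the loss of \<open>y\<close> on
        \<open>{b..V}\<close> outweighs the weighted integral of \<open>p\<close>. As
        \<open>y V \<ge> 0\<close>, that loss is at most \<open>y b \<le> y s\<close>.\<close>
      have "y V + \<phi> (x s) * integral {b..V} p \<le> y b + \<phi> (x s) * integral {b..b} p"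
      proof (rule antimono_if_antimono_on_partition[OF t,
            where w = "\<lambda>v. y v + \<phi> (x s) * integral {b..v} p"])
        \<comment> \<open>Continuity is local: near \<open>v\<close> the ray agrees with
          \<open>{b..v + 1}\<close>, which does not end at \<open>v\<close>.\<close>
        have "continuous_on {b..} (\<lambda>v. integral {b..v} p)"
        proof (subst continuous_on_eq_continuous_within, intro ballI)
          fix v assume v: "v \<in> {b..}"
          have "continuous (at v within {b..v + 1}) (\<lambda>v. integral {b..v} p)"
            using v by (intro DERIV_continuous[OF integral_has_real_derivative[OF p_cont']]) auto
          moreover have "at v within {b..v + 1} = at v within {b..}"
            using v by (intro at_within_nhd[of v "{..<v + 1}"]) auto
          ultimately show "continuous (at v within {b..}) (\<lambda>v. integral {b..v} p)"
            by simp
        qed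
        then show "continuous_on {t m..} (\<lambda>v. y v + \<phi> (x s) * integral {b..v} p)"
          using s sb a unfolding b_def[symmetric]
          by (intro continuous_intros continuous_on_subset[OF y_cont]) auto
        fix k v assume k: "m \<le> k" "t k < v" "v < t (k + 1)"
        have bv: "b < v"
          using t_mono[OF k(1)] k by (simp add: b_def)
        have "((\<lambda>v. integral {b..v} p) has_real_derivative p v) (at v within {b..v + 1})"
          using bv by (intro integral_has_real_derivative p_cont') auto
        then have "((\<lambda>v. integral {b..v} p) has_real_derivative p v) (at v)"
          using bv by (simp add: at_within_Icc_at)
        then have "((\<lambda>v. y v + \<phi> (x s) * integral {b..v} p) has_real_derivative
            - f v (x (\<gamma> v)) + \<phi> (x s) * p v) (at v)"
          using y_deriv[of k v] m k by (intro DERIV_add DERIV_cmult) auto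
        moreover have "\<phi> (x s) * p v \<le> f v (x (\<gamma> v))"
        proof -
          have "s \<le> \<gamma> v"
            using piecewise_constant_argument_ge[OF pca, of m v] bv sb by (simp add: b_def)
          then have "\<phi> (x s) \<le> \<phi> (x (\<gamma> v))"
            using s by (intro monoD[OF phi_mono] x_incr) auto
          then have "\<phi> (x s) * p v \<le> p v * \<phi> (x (\<gamma> v))"
            using p_nonneg[of v] s sb bv a by (simp add: mult.commute mult_left_mono)
          also have "\<dots> \<le> f v (x (\<gamma> v))"
            using s sb bv by (intro f_bound) auto
          finally show ?thesis .
        qed
        ultimately show "\<exists>d. ((\<lambda>v. y v + \<phi> (x s) * integral {b..v} p) has_real_derivative d) (at v)
            \<and> d \<le> 0"
          by force
      qed (use V in \<open>auto simp: b_def\<close>)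
      moreover have "y b \<le> y s" "0 \<le> y V"
        using y_decr[of s b] y_nonneg[of V] s sb V by auto
      ultimately show ?thesis by simp
    qed
    then have "\<forall>\<^sub>F V in at_top. \<phi> (x s) * integral {b..V} p \<le> y s"
      by (auto simp: eventually_at_top_linorder)
    moreover have "((\<lambda>V. \<phi> (x s) * integral {b..V} p) \<longlongrightarrow> \<phi> (x s) * P b) at_top"
      using s sb a by (intro tendsto_intros P_lim) auto
    ultimately show ?thesis
      unfolding m_def[symmetric] b_def[symmetric]
      by (intro tendsto_upperbound[of _ _ at_top]) auto
  qed

  \<comment> \<open>A bounded antiderivative along \<open>x\<close> and the contradiction\<close>
  define c where "c = x a"
  have c: "0 < c" using x_pos[of a] a by (simp add: c_def)
  have x_ge: "c \<le> x s" if "a \<le> s" for s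
    using x_incr[of a s] that by (simp add: c_def)
  \<comment> \<open>Starting the integrals below \<open>c\<close> makes \<open>G\<close> two-sided differentiable at \<open>c\<close>.\<close>
  define G where "G = (\<lambda>v. integral {c/2..v} (\<lambda>u. 1 / \<phi> u))"
  \<comment> \<open>The start \<open>c/4\<close> lies strictly below \<open>c/2\<close>, as the
    bound by the integral over an open ray demands, and stays away from the zero of
    \<open>\<phi>\<close> at 0.\<close>
  have q_cont: "continuous_on {c/4..v} (\<lambda>u. 1 / \<phi> u)" for v
  proof (intro continuous_intros continuous_on_subset[OF phi_cont] ballI)
    show "\<phi> u \<noteq> 0" if "u \<in> {c/4..v}" for u
      using phi_pos[of u] that c by auto
  qed (use c in auto)
  \<comment> \<open>If \<open>\<epsilon> < c/4\<close>, the compact piece is empty and the ray alone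
    covers the domain.\<close>
  have "set_integrable lborel ({c/4..\<epsilon>} \<union> {\<epsilon><..}) (\<lambda>u. 1 / \<phi> u)"
    by (intro set_integrable_Un borel_integrable_atLeastAtMost' q_cont phi_int) auto
  then have q_int: "set_integrable lborel {c/4<..} (\<lambda>u. 1 / \<phi> u)"
    by (rule set_integrable_subset) auto
  have G_le: "G v \<le> (LBINT u:{c/4<..}. 1 / \<phi> u)" for v
    unfolding G_def
  proof (rule interval_integral_to_infinity(2)[OF q_int])
    show "0 \<le> 1 / \<phi> u" if "c / 4 < u" for u
      using phi_pos[of u] that c by simp
  qed (use c in auto)
  have G_deriv: "(G has_real_derivative 1 / \<phi> v) (at v)" if "c \<le> v" for v
  proof -
    have "(G has_real_derivative 1 / \<phi> v) (at v within {c/2..v + 1})"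
      unfolding G_def using that c
      by (intro integral_has_real_derivative continuous_on_subset[OF q_cont]) auto
    then show ?thesis
      using that c by (simp add: at_within_Icc_at)
  qed
  obtain M where M: "0 \<le> M" "\<And>s. s \<in> {\<tau>..a} \<Longrightarrow> 1 / r s \<le> M"
    using inv_r by blast
  have C: "0 \<le> C"
    unfolding C_def set_lebesgue_integral_def using p_nonneg
    by (intro integral_nonneg_AE AE_I2) (auto split: split_indicator)
  have "(\<integral>\<^sup>+ s\<in>{\<tau>..}. ennreal (1 / r s * P (t (interval_index t s + 1))) \<partial>lborel) < \<infinity>"
  proof (rule nn_set_integral_finite_if_bounded_antiderivative)
    show "\<tau> \<le> a" using a by simp
    show "1 / r s * P (t (interval_index t s + 1)) \<le> M * C" if "\<tau> \<le> s" "s \<le> a" for s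
    proof -
      have "P (t (interval_index t s + 1)) \<le> C"
        using idx(2)[of s] that by (intro P_le) auto
      then have "1 / r s * P (t (interval_index t s + 1)) \<le> 1 / r s * C"
        using r_pos[of s] that by (intro mult_left_mono) auto
      also have "\<dots> \<le> M * C"
        using M C that by (intro mult_right_mono) auto
      finally show ?thesis .
    qed
    \<comment> \<open>This is \<open>y_ge\<close> divided by \<open>r s * \<phi> (x s)\<close>; the
      right-hand side is the derivative of \<open>G (x s)\<close>, and \<open>G\<close> is bounded
      above.\<close>
    show "1 / r s * P (t (interval_index t s + 1)) \<le> 1 / \<phi> (x s) * x' s" if "a \<le> s" for s
    proof -
      have "0 < r s" "0 < \<phi> (x s)"
        using that a by (auto intro!: r_pos phi_pos x_pos)
      then show ?thesis
        using y_ge[OF that] by (simp add: y_def field_simps)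
    qed
    show "0 \<le> 1 / \<phi> (x s) * x' s" if "a \<le> s" for s
      using x'_nonneg[OF that] phi_pos[of "x s"] x_pos[of s] that a by simp
    have "continuous_on {a..} x"
      using sol a unfolding is_solution_def by (auto elim: continuous_on_subset)
    then have "continuous_on {a..} (\<lambda>s. \<phi> (x s))"
      using x_pos a by (intro continuous_on_compose2[OF phi_cont]) force+
    moreover have "continuous_on {a..} x'"
      using a by (intro continuous_on_subset[OF x'_cont]) auto
    moreover have "\<phi> (x s) \<noteq> 0" if "a \<le> s" for s
      using phi_pos[of "x s"] x_pos[of s] that a by simp
    ultimately show "continuous_on {a..} (\<lambda>s. 1 / \<phi> (x s) * x' s)"
      by (intro continuous_intros) auto
    show "((\<lambda>s. G (x s)) has_real_derivative 1 / \<phi> (x s) * x' s) (at s)" if "a \<le> s" for s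
      using that a x_ge by (intro DERIV_chain2[OF G_deriv x_deriv]) auto
  qed (rule G_le)
  then show False
    unfolding P_def rp_int by simp
qed

lemma is_solution_uminus:
  assumes "is_solution \<tau> t \<gamma> r f x"
  shows "is_solution \<tau> t \<gamma> r (\<lambda>s u. - f s (- u)) (\<lambda>s. - x s)"
proof -
  obtain x' D where x: "continuous_on {\<tau>..} x"
    and x': "\<And>s. s \<ge> \<tau> \<Longrightarrow> (x has_real_derivative x' s) (at s within {\<tau>..})"
    and x'_cont: "continuous_on {\<tau>..} x'"
    and D: "\<And>s. s \<in> {\<tau>..} - range t \<Longrightarrow>
            ((\<lambda>u. r u * x' u) has_real_derivative D s) (at s within {\<tau>..})"
      "\<And>k. \<tau> \<le> t k \<Longrightarrow> \<exists>l. (D \<longlongrightarrow> l) (at_right (t k))"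
      "\<And>k. \<tau> < t k \<Longrightarrow> \<exists>l. (D \<longlongrightarrow> l) (at_left (t k))"
    and eq: "\<And>k s. {t k..<t (k + 1)} \<subseteq> {\<tau>..} \<Longrightarrow> s \<in> {t k..<t (k + 1)} \<Longrightarrow>
         \<exists>d. ((\<lambda>u. r u * x' u) has_real_derivative d) (at s within {t k..<t (k + 1)}) \<and>
                d + f s (x (\<gamma> s)) = 0"
    using assms unfolding is_solution_def by blast
  show ?thesis
    unfolding is_solution_def
  proof (rule conjI[rotated], rule exI[of _ "\<lambda>s. - x' s"],
      intro conjI exI[of _ "\<lambda>s. - D s"] allI impI ballI)
    show "continuous_on {\<tau>..} (\<lambda>s. - x s)" "continuous_on {\<tau>..} (\<lambda>s. - x' s)"
      using x x'_cont by (auto intro: continuous_on_minus)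
    show "((\<lambda>s. - x s) has_real_derivative - x' s) (at s within {\<tau>..})" if "s \<ge> \<tau>" for s
      using x'[OF that] by (rule DERIV_minus)
    show "((\<lambda>u. r u * - x' u) has_real_derivative - D s) (at s within {\<tau>..})"
      if "s \<in> {\<tau>..} - range t" for s
      using DERIV_minus[OF D(1)[OF that]] by simp
    show "\<exists>l. ((\<lambda>s. - D s) \<longlongrightarrow> l) (at_right (t k))" if "\<tau> \<le> t k" for k
      using D(2)[OF that] tendsto_minus by blast
    show "\<exists>l. ((\<lambda>s. - D s) \<longlongrightarrow> l) (at_left (t k))" if "\<tau> < t k" for k
      using D(3)[OF that] tendsto_minus by blast
    fix k s assume "{t k..<t (k + 1)} \<subseteq> {\<tau>..}" "s \<in> {t k..<t (k + 1)}"
    from eq[OF this] obtain d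
      where "((\<lambda>u. r u * x' u) has_real_derivative d) (at s within {t k..<t (k + 1)})"
        "d + f s (x (\<gamma> s)) = 0"
      by blast
    then show "\<exists>d. ((\<lambda>u. r u * - x' u) has_real_derivative d) (at s within {t k..<t (k + 1)}) \<and>
        d + - f s (- (- x (\<gamma> s))) = 0"
      by (intro exI[of _ "- d"]) (auto dest: DERIV_minus)
  qed
qed

text \<open>If neither strict sign persists, every threshold is followed by points of both weak
  signs; thresholds \<open>\<tau> + n\<close> give the two sequences.\<close>

lemma not_oscillatory_cases:
  assumes "\<not> oscillatory \<tau> g"
  obtains T where "\<And>s. s \<ge> T \<Longrightarrow> g s > 0" | T where "\<And>s. s \<ge> T \<Longrightarrow> g s < 0"
proof (rule ccontr)
  assume "\<not> thesis"
  then have "\<forall>T. \<exists>s\<ge>T. g s \<le> 0" "\<forall>T. \<exists>s\<ge>T. 0 \<le> g s"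
    using that by (meson not_le)+
  then obtain A B where A: "\<And>T. T \<le> A T" "\<And>T. g (A T) \<le> 0"
    and B: "\<And>T. T \<le> B T" "\<And>T. 0 \<le> g (B T)"
    by metis
  have lim: "filterlim (\<lambda>n. h (\<tau> + real n)) at_top sequentially"
    if "\<And>T. T \<le> h T" for h :: "real \<Rightarrow> real"
  proof (rule filterlim_at_top_mono)
    show "filterlim (\<lambda>n. \<tau> + real n) at_top sequentially"
      by (intro filterlim_tendsto_add_at_top[OF tendsto_const] filterlim_real_sequentially)
  qed (use that in auto)
  have ge: "\<tau> \<le> h (\<tau> + real n)" if "\<And>T. T \<le> h T" for h :: "real \<Rightarrow> real" and n
    using that[of "\<tau> + real n"] by linarith
  have "oscillatory \<tau> g"
    unfolding oscillatory_def
    using A B lim ge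
    by (intro exI[of _ "\<lambda>n. A (\<tau> + real n)"] exI[of _ "\<lambda>n. B (\<tau> + real n)"]) auto
  with assms show False ..
qed

theorem theorem2:
  fixes \<tau> \<epsilon> :: real
    and r p \<phi> \<gamma> :: "real \<Rightarrow> real"
    and f :: "real \<Rightarrow> real \<Rightarrow> real"
    and t \<zeta> :: "int \<Rightarrow> real"
  assumes r_cont: "continuous_on {\<tau>..} r"
    and r_pos: "\<And>s. s \<ge> \<tau> \<Longrightarrow> r s > 0"
    and f_cont: "continuous_on ({\<tau>..} \<times> UNIV) (\<lambda>(s, x). f s x)"
    and f_sign: "\<And>s x. s \<ge> \<tau> \<Longrightarrow> x \<noteq> 0 \<Longrightarrow> x * f s x > 0"
    and p_cont: "continuous_on {\<tau>..} p"
    and p_nonneg: "\<And>s. s \<ge> \<tau> \<Longrightarrow> p s \<ge> 0"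
    and phi_C1: "\<phi> C1_differentiable_on UNIV"
    and phi_mono: "mono \<phi>"
    and phi_sign: "\<And>x. x \<noteq> 0 \<Longrightarrow> x * \<phi> x > 0"
    and f_ge: "\<And>s x. s \<ge> \<tau> \<Longrightarrow> x \<noteq> 0 \<Longrightarrow> f s x / \<phi> x \<ge> p s"
    and gamma: "piecewise_constant_argument t \<zeta> \<gamma>"
    and r_int: "(\<integral>\<^sup>+ s\<in>{\<tau>..}. ennreal (1 / r s) \<partial>lborel) = \<infinity>"
    and eps: "\<epsilon> > 0"
    and phi_int_pos: "interval_lebesgue_integrable lborel (ereal \<epsilon>) \<infinity> (\<lambda>u. 1 / \<phi> u)"
    and phi_int_neg: "interval_lebesgue_integrable lborel (ereal (- \<epsilon>)) (- \<infinity>) (\<lambda>u. 1 / \<phi> u)"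
    and p_int: "interval_lebesgue_integrable lborel (ereal \<tau>) \<infinity> p"
    and rp_int: "(\<integral>\<^sup>+ s\<in>{\<tau>..}.
        ennreal (1 / r s * (LBINT u=ereal (t (interval_index t s + 1))..\<infinity>. p u)) \<partial>lborel) = \<infinity>"
  shows "\<forall>x. is_solution \<tau> t \<gamma> r f x \<longrightarrow> oscillatory \<tau> x"
proof (intro allI impI, rule ccontr)
  fix x assume sol: "is_solution \<tau> t \<gamma> r f x" and "\<not> oscillatory \<tau> x"
  have phi_pos: "\<phi> u > 0" if "u > 0" for u
    using phi_sign[of u] that by (simp add: zero_less_mult_iff)
  have phi_neg: "\<phi> u < 0" if "u < 0" for u
    using phi_sign[of u] that by (simp add: zero_less_mult_iff)
  have phi_cont: "continuous_on UNIV \<phi>"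
    by (rule C1_differentiable_imp_continuous_on[OF phi_C1])
  have p_int': "set_integrable lborel {\<tau><..} p"
    using p_int by (simp add: interval_integrable_to_infinity_eq)
  from \<open>\<not> oscillatory \<tau> x\<close> show False
  proof (cases rule: not_oscillatory_cases)
    case (1 T)
    show False
    proof (rule no_eventually_positive_solution[OF r_cont r_pos p_cont p_nonneg _ phi_mono phi_pos
          _ gamma r_int _ p_int' rp_int sol 1])
      show "continuous_on {0<..} \<phi>"
        using phi_cont by (rule continuous_on_subset) auto
      show "p s * \<phi> u \<le> f s u" if "s \<ge> \<tau>" "u > 0" for s u
        using f_ge[of s u] phi_pos[of u] that by (simp add: field_simps)
      show "set_integrable lborel {\<epsilon><..} (\<lambda>u. 1 / \<phi> u)"
        using phi_int_pos by (simp add: interval_integrable_to_infinity_eq)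
    qed
  next
    case (2 T)
    show False
    proof (rule no_eventually_positive_solution[where \<phi> = "\<lambda>u. - \<phi> (- u)" and T = T,
          OF r_cont r_pos p_cont p_nonneg _ _ _ _ gamma r_int _ p_int' rp_int
            is_solution_uminus[OF sol]])
      show "continuous_on {0<..} (\<lambda>u. - \<phi> (- u))"
        by (intro continuous_intros continuous_on_compose2[OF phi_cont]) auto
      show "mono (\<lambda>u. - \<phi> (- u))"
        by (intro monoI) (simp add: monoD[OF phi_mono])
      show "p s * - \<phi> (- u) \<le> - f s (- u)" if "s \<ge> \<tau>" "u > 0" for s u
        using f_ge[of s "- u"] phi_neg[of "- u"] that by (simp add: field_simps)
      \<comment> \<open>Integrability does not depend on orientation, so the limits may be swapped;
        reflecting \<open>u\<close> to \<open>- u\<close> then moves the integral to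
        \<open>{\<epsilon><..}\<close>.\<close>
      have "interval_lebesgue_integrable lborel (- \<infinity>) (ereal (- \<epsilon>)) (\<lambda>u. 1 / \<phi> u)"
        using phi_int_neg by (simp add: interval_lebesgue_integrable_def)
      then have "interval_lebesgue_integrable lborel (ereal \<epsilon>) \<infinity> (\<lambda>u. 1 / \<phi> (- u))"
        by (subst interval_integrable_mirror) simp
      then have "set_integrable lborel {\<epsilon><..} (\<lambda>u. (-1) * (1 / \<phi> (- u)))"
        by (intro set_integrable_mult_right) (simp add: interval_integrable_to_infinity_eq)
      then show "set_integrable lborel {\<epsilon><..} (\<lambda>u. 1 / - \<phi> (- u))"
        by simp
    qed (use phi_neg 2 in auto)
  qed
qed

end
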